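(* Let $\lambda_0\ge 1$ be an integer, $\alpha\ge 1$ a real number, and $\lambda_k=\lceil\lambda_0(k+1)^\alpha\rceil$ for $k\ge 0$. Let $\mathcal{L}^\#(\hat\lambda,\alpha)$ be the loss function of this restart strategy, and let $$\mathcal{L}^\#_{\mathrm{low}}(\hat\lambda,\alpha)=\begin{cases}\frac{\lambda_0}{\alpha+1}\left(\sqrt[\alpha]{\frac{\hat\lambda-1}{\lambda_0}}-1\right)^{\alpha+1} & \text{for } \hat\lambda>\lambda_0,\\ 0 & \text{for } \hat\lambda=\lambda_0.\end{cases}$$ Then $\mathcal{L}^\#_{\mathrm{low}}(\hat\lambda,\alpha)$ is a lower bound of $\mathcal{L}^\#(\hat\lambda,\alpha)$, i.e. $\mathcal{L}^\#(\hat\lambda,\alpha)\ge\mathcal{L}^\#_{\mathrm{low}}(\hat\lambda,\alpha)$ for all integers $\hat\lambda\ge\lambda_0$.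
   Context: For a restart strategy $(\lambda_0,\lambda_1,\lambda_2,\ldots)$ (an unbounded sequence of natural numbers) and an integer $\hat\lambda\ge\lambda_0$, let $\hat k(\hat\lambda)=\min\{k\ge 0:\lambda_k\ge\hat\lambda\}$. The loss function is $\mathcal{L}(\hat\lambda)=\sum_{k=0}^{\hat k(\hat\lambda)}\lambda_k-\hat\lambda$; it is denoted $\mathcal{L}^\#(\hat\lambda,\alpha)$ for the strategy $\lambda_k=\lceil\lambda_0(k+1)^\alpha\rceil$. Here $\sqrt[\alpha]{x}=x^{1/\alpha}$ for real $x\ge 0$. *)

theory Defs
  imports Complex_Main
begin

definition restart_strategy :: "(nat \<Rightarrow> nat) \<Rightarrow> bool" where
  "restart_strategy lam \<longleftrightarrow> (\<forall>N. \<exists>k. N \<le> lam k)"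

(* LEAST is meaningful whenever lam is unbounded, i.e. a restart strategy. *)
definition k_hat :: "(nat \<Rightarrow> nat) \<Rightarrow> nat \<Rightarrow> nat" where
  "k_hat lam lamhat = (LEAST k. lamhat \<le> lam k)"

(* Integer-valued, so that the subtraction is not truncated. *)
definition loss :: "(nat \<Rightarrow> nat) \<Rightarrow> nat \<Rightarrow> int" where
  "loss lam lamhat = (\<Sum>k = 0..k_hat lam lamhat. int (lam k)) - int lamhat"

(* The argument of nat is never negative, so nothing is truncated. *)
definition power_strategy :: "nat \<Rightarrow> real \<Rightarrow> nat \<Rightarrow> nat" where
  "power_strategy lam0 \<alpha> k = nat \<lceil>real lam0 * (real k + 1) powr \<alpha>\<rceil>"

definition loss_sharp :: "nat \<Rightarrow> nat \<Rightarrow> real \<Rightarrow> int" where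
  "loss_sharp lam0 lamhat \<alpha> = loss (power_strategy lam0 \<alpha>) lamhat"

(* The else branch is the case lamhat = lam0; only lamhat \<ge> lam0 matters. *)
definition loss_sharp_low :: "nat \<Rightarrow> nat \<Rightarrow> real \<Rightarrow> real" where
  "loss_sharp_low lam0 lamhat \<alpha> =
     (if lamhat > lam0
      then real lam0 / (\<alpha> + 1) *
             (((real lamhat - 1) / real lam0) powr (1 / \<alpha>) - 1) powr (\<alpha> + 1)
      else 0)"

lemma power_strategy_0: "power_strategy lam0 \<alpha> 0 = lam0"
  by (simp add: power_strategy_def)

lemma restart_strategy_power_strategy:
  assumes "lam0 \<ge> 1" and "\<alpha> \<ge> 1"
  shows "restart_strategy (power_strategy lam0 \<alpha>)"
  unfolding restart_strategy_def
proof (intro allI exI)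
  fix N :: nat
  have "real N \<le> (real N + 1) powr 1"
    by simp
  also have "\<dots> \<le> (real N + 1) powr \<alpha>"
    using assms(2) by (intro powr_mono) auto
  also have "\<dots> \<le> real lam0 * (real N + 1) powr \<alpha>"
    using assms(1) by (simp add: mult_le_cancel_right1)
  finally show "N \<le> power_strategy lam0 \<alpha> N"
    unfolding power_strategy_def by linarith
qed

end

theory Submission
  imports Defs
begin

text \<open>Since \<open>\<lambda>\<^sub>K \<ge> \<lambda>\<close> for the target \<open>\<lambda>\<close> and \<open>K\<close> the index found by the strategy, the loss is at
  least \<open>\<lambda>\<^sub>0 + \<dots> + \<lambda>\<^sub>K\<^sub>-\<^sub>1\<close>, which dominates \<open>\<lambda>\<^sub>0 (1\<^sup>\<alpha> + \<dots> + K\<^sup>\<alpha>)\<close> and hence the integral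
  \<open>\<lambda>\<^sub>0 K\<^sup>\<alpha>\<^sup>+\<^sup>1 / (\<alpha> + 1)\<close>. Rounding costs less than one, so \<open>\<lambda>\<^sub>0 (K + 1)\<^sup>\<alpha> > \<lambda> - 1\<close>, which bounds \<open>K\<close>
  from below.\<close>

text \<open>Mean value theorem: the derivative \<open>p * z powr (p - 1)\<close> is nondecreasing in
  \<open>z\<close> because \<open>p \<ge> 1\<close>, so its value at the right endpoint bounds the
  increment.\<close>

lemma powr_Suc_diff_le:
  fixes p :: real
  assumes "p \<ge> 1"
  shows "real (Suc n) powr p - real n powr p \<le> p * real (Suc n) powr (p - 1)"
proof (cases "n = 0")
  case False
  \<comment> \<open>The derivative rule for \<open>powr\<close> needs a positive base on the whole
    closed interval, hence the separate case \<open>n = 0\<close>.\<close>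
  have "\<exists>z>real n. z < real (Suc n) \<and> real (Suc n) powr p - real n powr p
      = (real (Suc n) - real n) * (p * z powr (p - 1))"
    using False by (intro MVT2 has_real_derivative_powr) auto
  then obtain z where z: "real n < z" "z < real (Suc n)"
    and eq: "real (Suc n) powr p - real n powr p = p * z powr (p - 1)"
    by auto
  have "z powr (p - 1) \<le> real (Suc n) powr (p - 1)"
    using z assms by (intro powr_mono2) auto
  with eq assms show ?thesis by (simp add: mult_left_mono)
qed (use assms in simp)

text \<open>Discrete form of the integral comparison: the increments of
  \<open>x powr (a + 1) / (a + 1)\<close> telescope, each being at most the matching
  summand.\<close>

lemma powr_le_sum_powr:
  fixes a :: real
  assumes "a \<ge> 0"
  shows "real n powr (a + 1) / (a + 1) \<le> (\<Sum>k<n. real (Suc k) powr a)"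
proof (induction n)
  case (Suc n)
  have "real (Suc n) powr (a + 1) / (a + 1) - real n powr (a + 1) / (a + 1)
      \<le> real (Suc n) powr a"
    using powr_Suc_diff_le[of "a + 1" n] assms
    by (simp add: diff_divide_distrib[symmetric] pos_divide_le_eq mult.commute)
  with Suc show ?case by simp
qed simp

lemma le_k_hat:
  assumes "restart_strategy lam"
  shows "N \<le> lam (k_hat lam N)"
  using assms unfolding restart_strategy_def k_hat_def by (metis LeastI)

text \<open>The last summand of the loss is at least \<open>N\<close> and so pays for the subtracted
  \<open>N\<close>.\<close>

lemma loss_ge_sum:
  assumes "restart_strategy lam"
  shows "(\<Sum>k<k_hat lam N. int (lam k)) \<le> loss lam N"
  using le_k_hat[OF assms, of N]
  by (simp add: loss_def atLeast0AtMost flip: lessThan_Suc_atMost)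

lemma loss_sharp_ge:
  assumes "lam0 \<ge> 1" "\<alpha> \<ge> 1"
  shows "real lam0 / (\<alpha> + 1) * real (k_hat (power_strategy lam0 \<alpha>) N) powr (\<alpha> + 1)
    \<le> real_of_int (loss_sharp lam0 N \<alpha>)"
proof -
  let ?K = "k_hat (power_strategy lam0 \<alpha>) N"
  have "real lam0 / (\<alpha> + 1) * real ?K powr (\<alpha> + 1)
      = real lam0 * (real ?K powr (\<alpha> + 1) / (\<alpha> + 1))"
    by simp
  also have "\<dots> \<le> real lam0 * (\<Sum>k<?K. real (Suc k) powr \<alpha>)"
    using assms by (intro mult_left_mono powr_le_sum_powr) auto
  also have "\<dots> = (\<Sum>k<?K. real lam0 * (real k + 1) powr \<alpha>)"
    by (simp add: sum_distrib_left add.commute)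
  also have "\<dots> \<le> (\<Sum>k<?K. real (power_strategy lam0 \<alpha> k))"
    by (intro sum_mono) (simp add: power_strategy_def)
  also have "\<dots> = real_of_int (\<Sum>k<?K. int (power_strategy lam0 \<alpha> k))"
    by simp
  also have "\<dots> \<le> real_of_int (loss_sharp lam0 N \<alpha>)"
    unfolding loss_sharp_def of_int_le_iff
    by (intro loss_ge_sum restart_strategy_power_strategy assms)
  finally show ?thesis .
qed

lemma root_le_k_hat:
  assumes "lam0 \<ge> 1" "\<alpha> \<ge> 1" "N \<ge> 1"
  shows "((real N - 1) / real lam0) powr (1 / \<alpha>) - 1 \<le> real (k_hat (power_strategy lam0 \<alpha>) N)"
proof -
  let ?K = "k_hat (power_strategy lam0 \<alpha>) N"
  have "N \<le> power_strategy lam0 \<alpha> ?K"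
    by (intro le_k_hat restart_strategy_power_strategy assms)
  with \<open>N \<ge> 1\<close> have "real N - 1 \<le> real lam0 * (real ?K + 1) powr \<alpha>"
    unfolding power_strategy_def by linarith
  with assms have "(real N - 1) / real lam0 \<le> (real ?K + 1) powr \<alpha>"
    by (simp add: pos_divide_le_eq mult.commute)
  \<comment> \<open>\<open>N \<ge> 1\<close> makes the base nonnegative, as monotonicity of
    \<open>powr\<close> requires.\<close>
  then have "((real N - 1) / real lam0) powr (1 / \<alpha>) \<le> ((real ?K + 1) powr \<alpha>) powr (1 / \<alpha>)"
    using assms by (intro powr_mono2) auto
  also have "\<dots> = real ?K + 1"
    using assms by (simp add: powr_powr)
  finally show ?thesis by simp
qed

theorem theorem8:
  fixes lam0 :: nat and \<alpha> :: real
  assumes "lam0 \<ge> 1" and "\<alpha> \<ge> 1"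
  shows "\<forall>lamhat::nat. lamhat \<ge> lam0 \<longrightarrow>
           real_of_int (loss_sharp lam0 lamhat \<alpha>) \<ge> loss_sharp_low lam0 lamhat \<alpha>"
proof (intro allI impI)
  fix N :: nat
  assume "N \<ge> lam0"
  let ?K = "k_hat (power_strategy lam0 \<alpha>) N"
  let ?r = "((real N - 1) / real lam0) powr (1 / \<alpha>)"
  have "loss_sharp_low lam0 N \<alpha> \<le> real lam0 / (\<alpha> + 1) * real ?K powr (\<alpha> + 1)"
  proof (cases "N > lam0")
    case True
    \<comment> \<open>Integrality turns \<open>N > lam0\<close> into
      \<open>N - 1 \<ge> lam0\<close>; this makes \<open>?r - 1\<close> nonnegative, so raising to
      the power \<open>\<alpha> + 1\<close> preserves the bound on \<open>?K\<close>.\<close>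
    then have "1 \<le> (real N - 1) / real lam0"
      using assms by simp
    then have "1 \<le> ?r"
      using assms by (intro ge_one_powr_ge_zero) auto
    then have "(?r - 1) powr (\<alpha> + 1) \<le> real ?K powr (\<alpha> + 1)"
      using assms True by (intro powr_mono2 root_le_k_hat) auto
    with True assms show ?thesis
      by (simp add: loss_sharp_low_def mult_left_mono divide_right_mono)
  qed (use assms in \<open>simp add: loss_sharp_low_def\<close>)
  also have "\<dots> \<le> real_of_int (loss_sharp lam0 N \<alpha>)"
    by (rule loss_sharp_ge[OF assms])
  finally show "loss_sharp_low lam0 N \<alpha> \<le> real_of_int (loss_sharp lam0 N \<alpha>)" .
qed

end
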